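(* Let $a>1$ and $\rho\ge 4$, and let $f\in C_\rho[0,\infty)$ be such that $f',f''\in C_\rho[0,\infty)$. Then, for every $b>0$, $$\lim_{n\to\infty}n\{S_{n,a}^*(f;x)-f(x)\}=\frac{-x}{2}\left(f'(x)\log a-f''(x)\right)$$ uniformly for $x\in[0,b]$.
   Context: For $a>1$, $n\in\mathbb{N}=\{1,2,\dots\}$ and $x\ge 0$, the operator $S_{n,a}^*$ is defined by $$S_{n,a}^*(f;x)=\sum_{k=0}^{\infty}a^{\left(\frac{-x}{-1+a^{1/n}}\right)}\frac{(x\log a)^k}{(-1+a^{1/n})^k\,k!}\,f\!\left(\frac{k}{n}\right),$$ for functions $f:[0,\infty)\to\mathbb{R}$ for which the series converges ($\log$ is the natural logarithm, and $0^0=1$). For $\rho>0$, $C_\rho[0,\infty)$ is the space of $f\in C[0,\infty)$ for which $\lim_{x\to\infty}\frac{f(x)}{1+x^\rho}$ exists and is finite. Derivatives at $0$ are one-sided. *)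

theory Defs
  imports "HOL-Analysis.Analysis"
begin

text \<open>Functions on \<open>[0,\<infinity>)\<close> are represented by total functions on the reals;
  only their values on \<open>{0..}\<close> matter.\<close>

definition S_op :: "nat \<Rightarrow> real \<Rightarrow> (real \<Rightarrow> real) \<Rightarrow> real \<Rightarrow> real" where
  "S_op n a f x =
     (\<Sum>k. a powr (- x / (-1 + a powr (1 / real n)))
          * ((x * ln a) ^ k / ((-1 + a powr (1 / real n)) ^ k * fact k))
          * f (real k / real n))"

definition C_space :: "real \<Rightarrow> (real \<Rightarrow> real) set" where
  "C_space \<rho> = {f. continuous_on {0..} f \<and>
                   (\<exists>L. ((\<lambda>x. f x / (1 + x powr \<rho>)) \<longlongrightarrow> L) at_top)}"

end

theory Submission
  imports Defs "HOL-Real_Asymp.Real_Asymp"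
begin

text \<open>
  Put \<open>h = a powr (1/n) - 1\<close> and \<open>\<mu> = x * ln a / h\<close>.  Since \<open>a powr (- x / h) = exp (- \<mu>)\<close>, the
  value \<open>S_op n a f x\<close> is the mean of \<open>f (k / n)\<close> for a Poisson variable \<open>k\<close> of parameter \<open>\<mu>\<close>, and
  \<open>\<mu> = n * x * q\<close> with \<open>q = ln a / (n * h)\<close>.  As \<open>n \<longlonglongrightarrow> \<infinity>\<close> one has \<open>q \<longlonglongrightarrow> 1\<close> and, more precisely,
  \<open>n * (q - 1) \<longlonglongrightarrow> - ln a / 2\<close>.  Expanding \<open>f\<close> to second order at \<open>x\<close> and taking means, the term in
  \<open>f' x\<close> is multiplied by \<open>n * x * (q - 1)\<close>, which tends to \<open>- x * ln a / 2\<close>, and the term in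
  \<open>f'' x / 2\<close> by \<open>x\<^sup>2 * n * (q - 1)\<^sup>2 + x * q\<close>, which tends to \<open>x\<close>.  This is the asserted limit.

  The remainder needs care because \<open>f\<close> may grow like a power of arbitrary order \<open>\<rho>\<close>.  All powers
  are dominated by \<open>exp\<close>, so the remainder at \<open>t\<close> is at most
  \<open>\<epsilon> * (t - x)\<^sup>2 + C * (t - x) ^ 4 * exp t\<close>, uniformly for \<open>x\<close> in \<open>[0, b]\<close>
  (lemma \<open>taylor_remainder_bound\<close>): near \<open>x\<close> by uniform continuity of \<open>f''\<close>, away from \<open>x\<close> by
  growth.  The factor \<open>exp (k / n)\<close> turns the Poisson weight of parameter \<open>\<mu>\<close> into a constant
  multiple of the weight of parameter \<open>\<mu> * exp (1 / n)\<close> (lemma \<open>poisson_weight_tilt\<close>), so moments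
  of arbitrary order \<open>\<rho>\<close> never occur: the explicit second and fourth Poisson moments suffice.
\<close>

section \<open>Moments of the Poisson weights\<close>

definition poisson_weight :: "real \<Rightarrow> nat \<Rightarrow> real" where
  "poisson_weight \<mu> k = exp (- \<mu>) * \<mu> ^ k / fact k"

lemma poisson_weight_nonneg: "\<mu> \<ge> 0 \<Longrightarrow> poisson_weight \<mu> k \<ge> 0"
  by (simp add: poisson_weight_def)

lemma poisson_weight_sums: "poisson_weight \<mu> sums 1"
proof -
  have "(\<lambda>k. exp (- \<mu>) * (\<mu> ^ k /\<^sub>R fact k)) sums (exp (- \<mu>) * exp \<mu>)"
    by (intro sums_mult exp_converges)
  moreover have "(\<lambda>k. exp (- \<mu>) * (\<mu> ^ k /\<^sub>R fact k)) = poisson_weight \<mu>"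
    by (auto simp: poisson_weight_def field_simps)
  ultimately show ?thesis
    by (simp add: exp_minus)
qed

text \<open>
  Stein's identity for the Poisson distribution, a shift of the summation index.  Iterated, it
  yields all factorial moments.
\<close>

lemma poisson_stein:
  assumes "(\<lambda>k. poisson_weight \<mu> k * g (Suc k)) sums s"
  shows "(\<lambda>k. poisson_weight \<mu> k * (real k * g k)) sums (\<mu> * s)"
proof -
  have "(\<lambda>k. \<mu> * (poisson_weight \<mu> k * g (Suc k))) sums (\<mu> * s)"
    by (intro sums_mult assms)
  moreover have "poisson_weight \<mu> (Suc k) * (real (Suc k) * g (Suc k))
      = \<mu> * (poisson_weight \<mu> k * g (Suc k))" for k
    by (simp add: poisson_weight_def field_simps del: of_nat_Suc)
  ultimately have "(\<lambda>k. poisson_weight \<mu> (Suc k) * (real (Suc k) * g (Suc k))) sums (\<mu> * s)"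
    by (simp only:)
  then show ?thesis
    by (subst (asm) sums_Suc_iff) simp
qed

lemma poisson_factorial_moments:
  shows "(\<lambda>k. poisson_weight \<mu> k * real k) sums \<mu>"
    and "(\<lambda>k. poisson_weight \<mu> k * (real k * (real k - 1))) sums \<mu>\<^sup>2"
    and "(\<lambda>k. poisson_weight \<mu> k * (real k * ((real k - 1) * (real k - 2)))) sums \<mu> ^ 3"
    and "(\<lambda>k. poisson_weight \<mu> k * (real k * ((real k - 1) * ((real k - 2) * (real k - 3))))) sums \<mu> ^ 4"
proof -
  show 1: "(\<lambda>k. poisson_weight \<mu> k * real k) sums \<mu>"
    using poisson_stein[of \<mu> "\<lambda>_. 1" 1] poisson_weight_sums by simp
  show 2: "(\<lambda>k. poisson_weight \<mu> k * (real k * (real k - 1))) sums \<mu>\<^sup>2"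
    using poisson_stein[of \<mu> "\<lambda>k. real k - 1" \<mu>] 1 by (simp add: power2_eq_square)
  show 3: "(\<lambda>k. poisson_weight \<mu> k * (real k * ((real k - 1) * (real k - 2)))) sums \<mu> ^ 3"
    using poisson_stein[of \<mu> "\<lambda>k. (real k - 1) * (real k - 2)" "\<mu>\<^sup>2"] 2
    by (simp add: power2_eq_square power3_eq_cube mult.assoc)
  show "(\<lambda>k. poisson_weight \<mu> k * (real k * ((real k - 1) * ((real k - 2) * (real k - 3))))) sums \<mu> ^ 4"
    using poisson_stein[of \<mu> "\<lambda>k. (real k - 1) * ((real k - 2) * (real k - 3))" "\<mu> ^ 3"] 3
    by (simp add: power_numeral_reduce)
qed

lemma poisson_moment_1: "(\<lambda>k. poisson_weight \<mu> k * (real k - c)) sums (\<mu> - c)"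
  using sums_diff[OF poisson_factorial_moments(1) sums_mult[OF poisson_weight_sums, of c]]
  by (simp add: algebra_simps)

lemma poisson_moment_2: "(\<lambda>k. poisson_weight \<mu> k * (real k - c)\<^sup>2) sums ((\<mu> - c)\<^sup>2 + \<mu>)"
proof -
  note F = poisson_factorial_moments[of \<mu>]
  have "(\<lambda>k. poisson_weight \<mu> k * (real k * (real k - 1))
      + (1 - 2 * c) * (poisson_weight \<mu> k * real k) + c\<^sup>2 * poisson_weight \<mu> k)
      sums (\<mu>\<^sup>2 + (1 - 2 * c) * \<mu> + c\<^sup>2 * 1)"
    by (intro sums_add sums_mult F poisson_weight_sums)
  also have "(\<lambda>k. poisson_weight \<mu> k * (real k * (real k - 1))
      + (1 - 2 * c) * (poisson_weight \<mu> k * real k) + c\<^sup>2 * poisson_weight \<mu> k)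
      = (\<lambda>k. poisson_weight \<mu> k * (real k - c)\<^sup>2)"
    by (rule ext) algebra
  also have "\<mu>\<^sup>2 + (1 - 2 * c) * \<mu> + c\<^sup>2 * 1 = (\<mu> - c)\<^sup>2 + \<mu>"
    by algebra
  finally show ?thesis .
qed

lemma poisson_moment_4:
  "(\<lambda>k. poisson_weight \<mu> k * (real k - c) ^ 4) sums
     ((\<mu> - c) ^ 4 + 6 * (\<mu> - c)\<^sup>2 * \<mu> + 4 * (\<mu> - c) * \<mu> + \<mu> + 3 * \<mu>\<^sup>2)"
proof -
  note F = poisson_factorial_moments[of \<mu>]
  (* The coefficients are those of (k - c)^4 in the basis of falling factorials of k. *)
  have "(\<lambda>k. poisson_weight \<mu> k * (real k * ((real k - 1) * ((real k - 2) * (real k - 3))))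
      + (6 - 4 * c) * (poisson_weight \<mu> k * (real k * ((real k - 1) * (real k - 2))))
      + (7 - 12 * c + 6 * c\<^sup>2) * (poisson_weight \<mu> k * (real k * (real k - 1)))
      + (1 - 4 * c + 6 * c\<^sup>2 - 4 * c ^ 3) * (poisson_weight \<mu> k * real k)
      + c ^ 4 * poisson_weight \<mu> k)
      sums (\<mu> ^ 4 + (6 - 4 * c) * \<mu> ^ 3 + (7 - 12 * c + 6 * c\<^sup>2) * \<mu>\<^sup>2
        + (1 - 4 * c + 6 * c\<^sup>2 - 4 * c ^ 3) * \<mu> + c ^ 4 * 1)"
    by (intro sums_add sums_mult F poisson_weight_sums)
  also have "(\<lambda>k. poisson_weight \<mu> k * (real k * ((real k - 1) * ((real k - 2) * (real k - 3))))
      + (6 - 4 * c) * (poisson_weight \<mu> k * (real k * ((real k - 1) * (real k - 2))))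
      + (7 - 12 * c + 6 * c\<^sup>2) * (poisson_weight \<mu> k * (real k * (real k - 1)))
      + (1 - 4 * c + 6 * c\<^sup>2 - 4 * c ^ 3) * (poisson_weight \<mu> k * real k)
      + c ^ 4 * poisson_weight \<mu> k) = (\<lambda>k. poisson_weight \<mu> k * (real k - c) ^ 4)"
    by (rule ext) algebra
  also have "\<mu> ^ 4 + (6 - 4 * c) * \<mu> ^ 3 + (7 - 12 * c + 6 * c\<^sup>2) * \<mu>\<^sup>2
        + (1 - 4 * c + 6 * c\<^sup>2 - 4 * c ^ 3) * \<mu> + c ^ 4 * 1
      = (\<mu> - c) ^ 4 + 6 * (\<mu> - c)\<^sup>2 * \<mu> + 4 * (\<mu> - c) * \<mu> + \<mu> + 3 * \<mu>\<^sup>2"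
    by algebra
  finally show ?thesis .
qed

lemma poisson_weight_tilt:
  "poisson_weight \<mu> k * z ^ k = exp (\<mu> * (z - 1)) * poisson_weight (\<mu> * z) k"
  by (simp add: poisson_weight_def power_mult_distrib right_diff_distrib exp_diff exp_minus field_simps)

section \<open>Growth and Taylor remainder\<close>

lemma C_space_exp_bound:
  assumes "f \<in> C_space \<rho>" "\<rho> > 0"
  obtains K where "K \<ge> 0" "\<And>t. t \<ge> 0 \<Longrightarrow> \<bar>f t\<bar> \<le> K * exp t"
proof -
  from assms obtain L where cont: "continuous_on {0..} f"
    and L: "((\<lambda>x. f x / (1 + x powr \<rho>)) \<longlongrightarrow> L) at_top"
    by (auto simp: C_space_def)
  have "((\<lambda>x. (1 + x powr \<rho>) / exp x) \<longlongrightarrow> 0) at_top"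
    using assms(2) by real_asymp
  from tendsto_mult[OF L this]
  have "((\<lambda>x. (f x / (1 + x powr \<rho>)) * ((1 + x powr \<rho>) / exp x)) \<longlongrightarrow> 0) at_top"
    by simp
  moreover have "(f x / (1 + x powr \<rho>)) * ((1 + x powr \<rho>) / exp x) = f x / exp x" for x
    using powr_ge_zero[of x \<rho>] by (simp add: add_nonneg_eq_0_iff)
  ultimately have "((\<lambda>x. f x / exp x) \<longlongrightarrow> 0) at_top"
    by simp
  then have "\<forall>\<^sub>F x in at_top. \<bar>f x / exp x\<bar> < 1"
    by (drule_tac tendsto_rabs) (auto dest: order_tendstoD(2)[where a = 1])
  then obtain N where N: "\<And>x. x \<ge> N \<Longrightarrow> \<bar>f x / exp x\<bar> < 1"
    by (auto simp: eventually_at_top_linorder)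
  have "continuous_on {0..N} (\<lambda>x. f x / exp x)"
    by (intro continuous_intros continuous_on_subset[OF cont]) auto
  then have "bounded ((\<lambda>x. f x / exp x) ` {0..N})"
    by (intro compact_imp_bounded compact_continuous_image) auto
  then obtain B where B: "\<And>x. x \<in> {0..N} \<Longrightarrow> \<bar>f x / exp x\<bar> \<le> B"
    unfolding bounded_iff real_norm_def by blast
  show thesis
  proof
    show "max 1 B \<ge> 0"
      by simp
    show "\<bar>f t\<bar> \<le> max 1 B * exp t" if "t \<ge> 0" for t
    proof -
      have "\<bar>f t / exp t\<bar> \<le> max 1 B"
        unfolding le_max_iff_disj using N[of t] B[of t] that
        by (metis atLeastAtMost_iff less_imp_le linear)
      then show ?thesis
        by (simp add: abs_divide pos_divide_le_eq)
    qed
  qed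
qed

text \<open>
  Two applications of the mean value inequality.  Unlike Taylor's theorem with Lagrange remainder
  on an open neighbourhood, this covers the endpoint \<open>0\<close>, where the derivatives are one-sided.
\<close>

lemma taylor_remainder_local:
  fixes f f' f'' :: "real \<Rightarrow> real"
  assumes f': "\<And>x. x \<ge> 0 \<Longrightarrow> (f has_real_derivative f' x) (at x within {0..})"
    and f'': "\<And>x. x \<ge> 0 \<Longrightarrow> (f' has_real_derivative f'' x) (at x within {0..})"
    and "x \<ge> 0" "t \<ge> 0"
    and osc: "\<And>s. s \<in> closed_segment x t \<Longrightarrow> \<bar>f'' s - f'' x\<bar> \<le> \<epsilon>"
  shows "\<bar>f t - f x - f' x * (t - x) - f'' x / 2 * (t - x)\<^sup>2\<bar> \<le> \<epsilon> * (t - x)\<^sup>2"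
proof -
  let ?S = "closed_segment x t"
  let ?g = "\<lambda>s. f s - f x - f' x * (s - x) - f'' x / 2 * (s - x)\<^sup>2"
  let ?g' = "\<lambda>s. f' s - f' x - f'' x * (s - x)"
  have S: "?S \<subseteq> {0..}"
    using assms(3,4) by (auto simp: closed_segment_eq_real_ivl split: if_splits)
  have d1: "(?g has_real_derivative ?g' s) (at s within ?S)" if "s \<in> ?S" for s
    using that S
    by (auto intro!: derivative_eq_intros has_field_derivative_subset[OF f' S])
  have d2: "(?g' has_real_derivative (f'' s - f'' x)) (at s within ?S)" if "s \<in> ?S" for s
    using that S
    by (auto intro!: derivative_eq_intros has_field_derivative_subset[OF f'' S])
  have "\<epsilon> \<ge> 0"
    using osc[of x] by simp
  have "\<bar>?g' s\<bar> \<le> \<epsilon> * \<bar>t - x\<bar>" if "s \<in> ?S" for s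
  proof -
    have "norm (?g' s - ?g' x) \<le> \<epsilon> * norm (s - x)"
      by (rule field_differentiable_bound[OF convex_closed_segment d2]) (use osc that in auto)
    also have "\<dots> \<le> \<epsilon> * \<bar>t - x\<bar>"
      using that \<open>\<epsilon> \<ge> 0\<close> by (intro mult_left_mono)
        (auto simp: closed_segment_eq_real_ivl split: if_splits)
    finally show ?thesis
      by simp
  qed
  then have "norm (?g t - ?g x) \<le> (\<epsilon> * \<bar>t - x\<bar>) * norm (t - x)"
    by (intro field_differentiable_bound[OF convex_closed_segment d1]) auto
  then show ?thesis
    by (simp add: power2_eq_square mult.assoc flip: abs_mult)
qed

text \<open>
  Close to \<open>x\<close> the first summand suffices, because \<open>f''\<close> oscillates little.  Farther away
  \<open>f t\<close> and the Taylor polynomial are both \<open>O(exp t)\<close>, and \<open>(t - x) ^ 4\<close> is bounded below.  The power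
  \<open>4\<close> is the point: a fourth central moment is \<open>O(1 / n\<^sup>2)\<close>, so it vanishes even after multiplication by \<open>n\<close>.
\<close>

lemma taylor_remainder_bound:
  fixes f f' f'' :: "real \<Rightarrow> real"
  assumes f': "\<And>x. x \<ge> 0 \<Longrightarrow> (f has_real_derivative f' x) (at x within {0..})"
    and f'': "\<And>x. x \<ge> 0 \<Longrightarrow> (f' has_real_derivative f'' x) (at x within {0..})"
    and cont: "continuous_on {0..} f''"
    and K: "K \<ge> 0" "\<And>t. t \<ge> 0 \<Longrightarrow> \<bar>f t\<bar> \<le> K * exp t"
    and M: "M \<ge> 0" "\<And>x. x \<in> {0..b} \<Longrightarrow> \<bar>f x\<bar> \<le> M \<and> \<bar>f' x\<bar> \<le> M \<and> \<bar>f'' x\<bar> \<le> M"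
    and "\<epsilon> > 0"
  obtains C where "C \<ge> 0" "\<And>x t. x \<in> {0..b} \<Longrightarrow> t \<ge> 0 \<Longrightarrow>
    \<bar>f t - f x - f' x * (t - x) - f'' x / 2 * (t - x)\<^sup>2\<bar> \<le> \<epsilon> * (t - x)\<^sup>2 + C * ((t - x) ^ 4 * exp t)"
proof -
  have "uniformly_continuous_on {0..b+1} f''"
    by (intro compact_uniformly_continuous continuous_on_subset[OF cont]) auto
  then obtain \<delta>0 where "\<delta>0 > 0" and \<delta>0: "\<And>x s. x \<in> {0..b+1} \<Longrightarrow> s \<in> {0..b+1} \<Longrightarrow>
      dist s x < \<delta>0 \<Longrightarrow> dist (f'' s) (f'' x) < \<epsilon>"
    unfolding uniformly_continuous_on_def using \<open>\<epsilon> > 0\<close> by metis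
  (* The cap at 1 keeps points near x inside {0..b+1}, where f'' is uniformly continuous. *)
  define \<delta> where "\<delta> = min \<delta>0 1"
  have "\<delta> > 0"
    using \<open>\<delta>0 > 0\<close> by (simp add: \<delta>_def)
  (* Far from x the remainder is at most (K + M * exp b) * exp t, and (t - x)^4 is at least \<delta>^4. *)
  define C where "C = (K + M * exp b) / \<delta> ^ 4"
  have "C \<ge> 0"
    using K(1) M(1) \<open>\<delta> > 0\<close> by (simp add: C_def)
  show thesis
  proof (rule that[OF \<open>C \<ge> 0\<close>])
    fix x t :: real
    assume x: "x \<in> {0..b}" and t: "t \<ge> 0"
    let ?R = "\<bar>f t - f x - f' x * (t - x) - f'' x / 2 * (t - x)\<^sup>2\<bar>"
    show "?R \<le> \<epsilon> * (t - x)\<^sup>2 + C * ((t - x) ^ 4 * exp t)"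
    proof (cases "\<bar>t - x\<bar> < \<delta>")
      case True
      have "?R \<le> \<epsilon> * (t - x)\<^sup>2"
      proof (rule taylor_remainder_local[OF f' f''])
        fix s
        assume "s \<in> closed_segment x t"
        then have "s \<in> {0..b+1} \<and> dist s x < \<delta>0"
          using True x t by (auto simp: \<delta>_def dist_real_def closed_segment_eq_real_ivl split: if_splits)
        then show "\<bar>f'' s - f'' x\<bar> \<le> \<epsilon>"
          using \<delta>0[of x s] x by (auto simp: dist_real_def)
      qed (use x t in auto)
      then show ?thesis
        using \<open>C \<ge> 0\<close> by (simp add: add_increasing2)
    next
      case False
      let ?d = "\<bar>t - x\<bar>"
      note Mx = M(2)[OF x]
      have "?R \<le> \<bar>f t\<bar> + \<bar>f x\<bar> + \<bar>f' x * (t - x)\<bar> + \<bar>f'' x / 2 * (t - x)\<^sup>2\<bar>"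
        by linarith
      also have "\<dots> = \<bar>f t\<bar> + \<bar>f x\<bar> + \<bar>f' x\<bar> * ?d + \<bar>f'' x\<bar> / 2 * ?d\<^sup>2"
        by (simp add: abs_mult)
      also have "\<dots> \<le> K * exp t + M + M * ?d + M / 2 * ?d\<^sup>2"
        using Mx K(2)[OF t] by (intro add_mono mult_right_mono divide_right_mono) auto
      also have "\<dots> = K * exp t + M * (1 + ?d + ?d\<^sup>2 / 2)"
        by (simp add: algebra_simps)
      also have "\<dots> \<le> K * exp t + M * exp (b + t)"
      proof -
        have "1 + ?d + ?d\<^sup>2 / 2 \<le> exp ?d"
          by (rule exp_lower_Taylor_quadratic) simp
        also have "\<dots> \<le> exp (b + t)"
          using x t by auto
        finally show ?thesis
          using M(1) by (intro add_left_mono mult_left_mono)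
      qed
      also have "\<dots> = C * (\<delta> ^ 4 * exp t)"
        using \<open>\<delta> > 0\<close> by (simp add: C_def exp_add field_simps)
      also have "\<dots> \<le> C * (?d ^ 4 * exp t)"
        using False \<open>\<delta> > 0\<close> \<open>C \<ge> 0\<close> by (intro mult_left_mono mult_right_mono power_mono) auto
      also have "?d ^ 4 = (t - x) ^ 4"
        by simp
      finally show ?thesis
        using \<open>\<epsilon> > 0\<close> by (simp add: add_increasing)
    qed
  qed
qed

section \<open>The mean of a Taylor expansion\<close>

text \<open>
  The last summand bounds the mean of \<open>(k / n - x) ^ 4 * exp (k / n)\<close>; by the tilting identity it is
  a fourth moment for the parameter \<open>n * x * p\<close>, where \<open>p = q * exp (1 / n)\<close>.  The bound already includes the
  convergence of the series that defines the mean of \<open>f\<close>.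
\<close>

lemma poisson_mean_taylor:
  fixes n :: nat and f :: "real \<Rightarrow> real" and x q p :: real
  defines "p \<equiv> q * exp (1 / real n)"
  assumes n: "n > 0" and x: "x \<ge> 0" and q: "q \<ge> 0"
    and R: "\<And>t. t \<ge> 0 \<Longrightarrow> \<bar>f t - f x - A * (t - x) - B / 2 * (t - x)\<^sup>2\<bar>
              \<le> \<epsilon> * (t - x)\<^sup>2 + C * ((t - x) ^ 4 * exp t)"
  shows "\<bar>real n * ((\<Sum>k. poisson_weight (n * x * q) k * f (k / n)) - f x)
            - A * (x * (n * (q - 1))) - B / 2 * (x\<^sup>2 * (n * (q - 1)\<^sup>2) + x * q)\<bar>
         \<le> \<epsilon> * (x\<^sup>2 * (n * (q - 1)\<^sup>2) + x * q)
            + C * (exp (x * (q * (n * (exp (1 / n) - 1)))) *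
                (x ^ 4 * (n * (p - 1) ^ 4) + 6 * x ^ 3 * ((p - 1)\<^sup>2 * p)
                  + 4 * x\<^sup>2 * ((p - 1) * p / n) + x * (p / n\<^sup>2) + 3 * x\<^sup>2 * (p\<^sup>2 / n)))"
proof -
  define \<mu> where "\<mu> = n * x * q"
  define w where "w = poisson_weight \<mu>"
  define r where "r t = f t - f x - A * (t - x) - B / 2 * (t - x)\<^sup>2" for t
  define m1 where "m1 = x * (q - 1)"
  define m2 where "m2 = x\<^sup>2 * (q - 1)\<^sup>2 + x * q / n"
  define m4 where "m4 = exp (x * (q * (n * (exp (1 / n) - 1)))) *
                (x ^ 4 * (p - 1) ^ 4 + 6 * x ^ 3 * ((p - 1)\<^sup>2 * p) / n
                  + 4 * x\<^sup>2 * ((p - 1) * p / n\<^sup>2) + x * (p / n ^ 3) + 3 * x\<^sup>2 * (p\<^sup>2 / n\<^sup>2))"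
  have w_nonneg: "w k \<ge> 0" for k
    using x q by (simp add: w_def \<mu>_def poisson_weight_nonneg)
  have s0: "w sums 1"
    unfolding w_def by (rule poisson_weight_sums)
  have s1: "(\<lambda>k. w k * (k / n - x)) sums m1"
  proof -
    have "(\<lambda>k. w k * (real k - n * x) / n) sums ((\<mu> - n * x) / n)"
      unfolding w_def by (intro sums_divide poisson_moment_1)
    moreover have "(\<lambda>k. w k * (real k - n * x) / n) = (\<lambda>k. w k * (k / n - x))"
      using n by (auto simp: field_simps)
    moreover have "(\<mu> - n * x) / n = m1"
      using n by (simp add: \<mu>_def m1_def field_simps)
    ultimately show ?thesis
      by simp
  qed
  have s2: "(\<lambda>k. w k * (k / n - x)\<^sup>2) sums m2"
  proof -
    have "(\<lambda>k. w k * (real k - n * x)\<^sup>2 / n\<^sup>2) sums (((\<mu> - n * x)\<^sup>2 + \<mu>) / n\<^sup>2)"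
      unfolding w_def by (intro sums_divide poisson_moment_2)
    moreover have "(real k - n * x)\<^sup>2 / n\<^sup>2 = (k / n - x)\<^sup>2" for k
      using n by (simp add: field_simps flip: power_divide)
    moreover have "((\<mu> - n * x)\<^sup>2 + \<mu>) / n\<^sup>2 = m2"
      using n by (simp add: \<mu>_def m2_def field_simps power2_eq_square)
    ultimately show ?thesis
      by (simp flip: times_divide_eq_right)
  qed
  have s4: "(\<lambda>k. w k * ((k / n - x) ^ 4 * exp (k / n))) sums m4"
  proof -
    define \<nu> where "\<nu> = \<mu> * exp (1 / n)"
    have "(\<lambda>k. exp (\<mu> * (exp (1 / n) - 1)) * (poisson_weight \<nu> k * (real k - n * x) ^ 4 / n ^ 4)) sums
        (exp (\<mu> * (exp (1 / n) - 1)) * (((\<nu> - n * x) ^ 4 + 6 * (\<nu> - n * x)\<^sup>2 * \<nu>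
            + 4 * (\<nu> - n * x) * \<nu> + \<nu> + 3 * \<nu>\<^sup>2) / n ^ 4))"
      by (intro sums_mult sums_divide poisson_moment_4)
    moreover have "exp (\<mu> * (exp (1 / n) - 1)) * (poisson_weight \<nu> k * (real k - n * x) ^ 4 / n ^ 4)
        = w k * ((k / n - x) ^ 4 * exp (k / n))" for k
    proof -
      have "(real k - n * x) ^ 4 / n ^ 4 = (k / n - x) ^ 4"
        using n by (simp add: field_simps flip: power_divide)
      moreover have "exp (\<mu> * (exp (1 / n) - 1)) * poisson_weight \<nu> k = w k * exp (k / n)"
        using poisson_weight_tilt[of \<mu> k "exp (1 / n)"]
        by (simp add: w_def \<nu>_def flip: exp_of_nat_mult)
      moreover have "exp (\<mu> * (exp (1 / n) - 1)) * (poisson_weight \<nu> k * (real k - n * x) ^ 4 / n ^ 4)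
          = exp (\<mu> * (exp (1 / n) - 1)) * poisson_weight \<nu> k * ((real k - n * x) ^ 4 / n ^ 4)"
        by simp
      ultimately show ?thesis
        by (simp only: mult_ac)
    qed
    moreover have "exp (\<mu> * (exp (1 / n) - 1)) * (((\<nu> - n * x) ^ 4 + 6 * (\<nu> - n * x)\<^sup>2 * \<nu>
            + 4 * (\<nu> - n * x) * \<nu> + \<nu> + 3 * \<nu>\<^sup>2) / n ^ 4) = m4"
    proof -
      have \<nu>: "\<nu> = n * (x * p)" "\<nu> - n * x = n * (x * (p - 1))"
        by (simp_all add: \<nu>_def \<mu>_def p_def algebra_simps)
      have "((\<nu> - n * x) ^ 4 + 6 * (\<nu> - n * x)\<^sup>2 * \<nu> + 4 * (\<nu> - n * x) * \<nu> + \<nu> + 3 * \<nu>\<^sup>2) / n ^ 4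
         = x ^ 4 * (p - 1) ^ 4 + 6 * x ^ 3 * ((p - 1)\<^sup>2 * p) / n
                  + 4 * x\<^sup>2 * ((p - 1) * p / n\<^sup>2) + x * (p / n ^ 3) + 3 * x\<^sup>2 * (p\<^sup>2 / n\<^sup>2)"
        unfolding \<nu>(2) unfolding \<nu>(1) using n
        by (simp add: power_mult_distrib add_divide_distrib) (simp add: field_simps power_numeral_reduce)
      moreover have "\<mu> * (exp (1 / n) - 1) = x * (q * (n * (exp (1 / n) - 1)))"
        by (simp add: \<mu>_def)
      ultimately show ?thesis
        unfolding m4_def by (simp only:)
    qed
    ultimately show ?thesis
      by simp
  qed
  have sb: "(\<lambda>k. \<epsilon> * (w k * (k / n - x)\<^sup>2) + C * (w k * ((k / n - x) ^ 4 * exp (k / n)))) sums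
      (\<epsilon> * m2 + C * m4)"
    by (intro sums_add sums_mult s2 s4)
  have dom: "norm (w k * r (k / n)) \<le>
      \<epsilon> * (w k * (k / n - x)\<^sup>2) + C * (w k * ((k / n - x) ^ 4 * exp (k / n)))" for k
  proof -
    have "norm (w k * r (k / n)) = w k * \<bar>r (k / n)\<bar>"
      using w_nonneg[of k] by (simp add: abs_mult)
    also have "\<dots> \<le> w k * (\<epsilon> * (k / n - x)\<^sup>2 + C * ((k / n - x) ^ 4 * exp (k / n)))"
      unfolding r_def by (intro mult_left_mono R w_nonneg) simp
    finally show ?thesis
      by (simp add: algebra_simps)
  qed
  have sr: "summable (\<lambda>k. w k * r (k / n))"
    by (rule summable_comparison_test'[OF sums_summable[OF sb] dom])
  have bound: "\<bar>\<Sum>k. w k * r (k / n)\<bar> \<le> \<epsilon> * m2 + C * m4"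
    using norm_suminf_le[OF dom sums_summable[OF sb]] sums_unique[OF sb] by simp
  have "(\<lambda>k. f x * w k + A * (w k * (k / n - x)) + B / 2 * (w k * (k / n - x)\<^sup>2) + w k * r (k / n))
      sums (f x * 1 + A * m1 + B / 2 * m2 + (\<Sum>k. w k * r (k / n)))"
    by (intro sums_add sums_mult s0 s1 s2 summable_sums[OF sr])
  moreover have "(\<lambda>k. f x * w k + A * (w k * (k / n - x)) + B / 2 * (w k * (k / n - x)\<^sup>2)
      + w k * r (k / n)) = (\<lambda>k. w k * f (k / n))"
    by (rule ext) (simp add: r_def algebra_simps)
  ultimately have "(\<lambda>k. w k * f (k / n)) sums (f x * 1 + A * m1 + B / 2 * m2 + (\<Sum>k. w k * r (k / n)))"
    by (simp only:)
  then have mean: "(\<Sum>k. w k * f (k / n)) = f x + A * m1 + B / 2 * m2 + (\<Sum>k. w k * r (k / n))"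
    by (simp add: sums_iff)
  have m: "x * (n * (q - 1)) = n * m1" "x\<^sup>2 * (n * (q - 1)\<^sup>2) + x * q = n * m2"
    "exp (x * (q * (n * (exp (1 / n) - 1)))) *
                (x ^ 4 * (n * (p - 1) ^ 4) + 6 * x ^ 3 * ((p - 1)\<^sup>2 * p)
                  + 4 * x\<^sup>2 * ((p - 1) * p / n) + x * (p / n\<^sup>2) + 3 * x\<^sup>2 * (p\<^sup>2 / n)) = n * m4"
    using n by (simp_all add: m1_def m2_def m4_def distrib_left power_numeral_reduce)
  have "real n * ((\<Sum>k. w k * f (k / n)) - f x) - A * (n * m1) - B / 2 * (n * m2)
      = n * (\<Sum>k. w k * r (k / n))"
    unfolding mean by (simp add: algebra_simps)
  also have "\<bar>\<dots>\<bar> \<le> n * (\<epsilon> * m2 + C * m4)"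
    using bound by (simp add: abs_mult mult_left_mono)
  finally show ?thesis
    unfolding m by (simp add: w_def \<mu>_def algebra_simps)
qed

lemma S_op_poisson:
  assumes "a > 1" "n > 0"
  shows "S_op n a f x =
    (\<Sum>k. poisson_weight (n * x * (ln a / (n * (exp (ln a / n) - 1)))) k * f (k / n))"
proof -
  define h where "h = exp (ln a / n) - 1"
  have h: "a powr (1 / real n) = 1 + h"
    using assms by (simp add: h_def powr_def)
  have \<mu>: "n * x * (ln a / (n * h)) = x * ln a / h"
    using assms by simp
  have "a powr (- x / h) = exp (- (x * ln a / h))"
    using assms by (simp add: powr_def)
  then show ?thesis
    unfolding S_op_def poisson_weight_def h h_def[symmetric] \<mu>
    by (simp add: power_divide)
qed

section \<open>The uniform limit\<close>

theorem theorem7p1: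
  fixes a \<rho> b :: real and f f' f'' :: "real \<Rightarrow> real"
  assumes "a > 1" and "\<rho> \<ge> 4"
    and "\<And>x. x \<ge> 0 \<Longrightarrow> (f has_real_derivative f' x) (at x within {0..})"
    and "\<And>x. x \<ge> 0 \<Longrightarrow> (f' has_real_derivative f'' x) (at x within {0..})"
    and "f \<in> C_space \<rho>" and "f' \<in> C_space \<rho>" and "f'' \<in> C_space \<rho>"
    and "b > 0"
  shows "uniform_limit {0..b}
           (\<lambda>n x. real n * (S_op n a f x - f x))
           (\<lambda>x. - x / 2 * (f' x * ln a - f'' x))
           sequentially"
proof (rule uniform_limitI)
  fix e :: real
  assume "e > 0"
  define \<epsilon> where "\<epsilon> = e / (2 * b)"
  (* The term with \<epsilon> contributes \<epsilon> * b = e / 2 in the limit; all other errors vanish. *)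
  have "\<epsilon> > 0" and \<epsilon>: "\<epsilon> * b < e"
    using \<open>e > 0\<close> \<open>b > 0\<close> by (simp_all add: \<epsilon>_def)
  obtain K where K: "K \<ge> 0" "\<And>t. t \<ge> 0 \<Longrightarrow> \<bar>f t\<bar> \<le> K * exp t"
    using C_space_exp_bound[OF assms(5)] \<open>\<rho> \<ge> 4\<close> by (metis less_le_trans zero_less_numeral)
  have bdd: "\<exists>M. \<forall>x\<in>{0..b}. \<bar>g x\<bar> \<le> M" if "g \<in> C_space \<rho>" for g
  proof -
    have "bounded (g ` {0..b})"
      using that by (intro compact_imp_bounded compact_continuous_image)
        (auto simp: C_space_def elim: continuous_on_subset)
    then show ?thesis
      by (auto simp: bounded_iff)
  qed
  obtain M0 M1 M2 where M012: "\<forall>x\<in>{0..b}. \<bar>f x\<bar> \<le> M0" "\<forall>x\<in>{0..b}. \<bar>f' x\<bar> \<le> M1" "\<forall>x\<in>{0..b}. \<bar>f'' x\<bar> \<le> M2"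
    using bdd assms(5-7) by metis
  define M where "M = \<bar>M0\<bar> + \<bar>M1\<bar> + \<bar>M2\<bar>"
  have "M \<ge> 0"
    by (simp add: M_def)
  have Mx: "\<bar>f x\<bar> \<le> M \<and> \<bar>f' x\<bar> \<le> M \<and> \<bar>f'' x\<bar> \<le> M" if "x \<in> {0..b}" for x
    using M012[THEN bspec, OF that] unfolding M_def by (intro conjI) linarith+
  note M = \<open>M \<ge> 0\<close> Mx
  obtain C where C: "C \<ge> 0" "\<And>x t. x \<in> {0..b} \<Longrightarrow> t \<ge> 0 \<Longrightarrow>
    \<bar>f t - f x - f' x * (t - x) - f'' x / 2 * (t - x)\<^sup>2\<bar> \<le> \<epsilon> * (t - x)\<^sup>2 + C * ((t - x) ^ 4 * exp t)"
    using taylor_remainder_bound[OF assms(3,4) _ K M \<open>\<epsilon> > 0\<close>] assms(7)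
    unfolding C_space_def by blast

  define l where "l = ln a"
  have "l > 0"
    using \<open>a > 1\<close> by (simp add: l_def)
  define q where "q n = l / (real n * (exp (l / real n) - 1))" for n
  define p where "p n = q n * exp (1 / real n)" for n
  define W where "W n = exp (b * (q n * (n * (exp (1 / n) - 1)))) *
      (b ^ 4 * (n * (p n - 1) ^ 4) + 6 * b ^ 3 * ((p n - 1)\<^sup>2 * p n)
        + 4 * b\<^sup>2 * (\<bar>p n - 1\<bar> * p n / n) + b * (p n / n\<^sup>2) + 3 * b\<^sup>2 * ((p n)\<^sup>2 / n))" for n :: nat
  (* U n bounds the error at n for all x in {0..b}, and C * W n its fourth-moment part. *)
  define U where "U n = M * (b * \<bar>n * (q n - 1) + l / 2\<bar>)
      + M / 2 * (b\<^sup>2 * (n * (q n - 1)\<^sup>2) + b * \<bar>q n - 1\<bar>)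
      + \<epsilon> * (b\<^sup>2 * (n * (q n - 1)\<^sup>2) + b * q n) + C * W n" for n :: nat

  have lim1: "(\<lambda>n. real n * (q n - 1) + l / 2) \<longlonglongrightarrow> 0"
    unfolding q_def using \<open>l > 0\<close> by (real_asymp simp: field_simps)
  have lim2: "q \<longlonglongrightarrow> 1"
    unfolding q_def using \<open>l > 0\<close> by real_asymp
  have lim3: "(\<lambda>n. real n * (q n - 1)\<^sup>2) \<longlonglongrightarrow> 0"
    unfolding q_def using \<open>l > 0\<close> by real_asymp
  have lim4: "(\<lambda>n. real n * (exp (1 / real n) - 1)) \<longlonglongrightarrow> 1"
    by real_asymp
  have lim5: "(\<lambda>n. inverse (real n)) \<longlonglongrightarrow> 0" and lim7: "(\<lambda>n. exp (1 / real n)) \<longlonglongrightarrow> 1"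
    by real_asymp+
  have lim6: "p \<longlonglongrightarrow> 1"
    unfolding p_def using tendsto_mult[OF lim2 lim7] by simp
  (* p - 1 is of order 1 / n, because n * (q - 1) and n * (exp (1 / n) - 1) both converge. *)
  have lim8: "(\<lambda>n. real n * (p n - 1) ^ 4) \<longlonglongrightarrow> 0"
  proof -
    let ?u = "\<lambda>n. (real n * (q n - 1) + l / 2 - l / 2) * exp (1 / real n) + real n * (exp (1 / real n) - 1)"
    have "(\<lambda>n. (?u n) ^ 4 * inverse (real n) ^ 3) \<longlonglongrightarrow> ((0 - l / 2) * 1 + 1) ^ 4 * 0 ^ 3"
      by (intro tendsto_intros lim1 lim4 lim5 lim7)
    moreover have "(?u n) ^ 4 * inverse (real n) ^ 3 = real n * (p n - 1) ^ 4" for n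
    proof (cases "n = 0")
      case False
      have "?u n = real n * (p n - 1)"
        by (simp add: p_def algebra_simps)
      then show ?thesis
        using False by (simp only: power_mult_distrib) (simp add: field_simps power_numeral_reduce)
    qed simp
    ultimately show ?thesis
      by simp
  qed
  have "W \<longlonglongrightarrow> exp (b * (1 * 1)) * (b ^ 4 * 0 + 6 * b ^ 3 * ((1 - 1)\<^sup>2 * 1)
        + 4 * b\<^sup>2 * (\<bar>1 - 1\<bar> * 1 * 0) + b * (1 * 0\<^sup>2) + 3 * b\<^sup>2 * (1\<^sup>2 * 0))"
    unfolding W_def divide_inverse power_inverse[symmetric] of_nat_power
    by (intro tendsto_intros lim2 lim4[unfolded divide_inverse] lim8 lim6 lim5)
  then have "W \<longlonglongrightarrow> 0"
    by simp
  have "U \<longlonglongrightarrow> M * (b * \<bar>0\<bar>) + M / 2 * (b\<^sup>2 * 0 + b * \<bar>1 - 1\<bar>) + \<epsilon> * (b\<^sup>2 * 0 + b * 1) + C * 0"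
    unfolding U_def by (intro tendsto_intros lim1 lim2 lim3 \<open>W \<longlonglongrightarrow> 0\<close>)
  then have "\<forall>\<^sub>F n in sequentially. U n < e"
    using \<epsilon> by (auto dest: order_tendstoD(2)[where a = e])
  then show "\<forall>\<^sub>F n in sequentially. \<forall>x\<in>{0..b}.
      dist (real n * (S_op n a f x - f x)) (- x / 2 * (f' x * ln a - f'' x)) < e"
    using eventually_gt_at_top[of 0]
  proof eventually_elim
    case (elim n)
    have q_pos: "q n > 0"
      using \<open>l > 0\<close> elim by (simp add: q_def)
    then have p_pos: "p n > 0"
      by (simp add: p_def)
    show ?case
    proof
      fix x
      assume x: "x \<in> {0..b}"
      then have x0: "0 \<le> x" "x \<le> b"
        by auto
      let ?T = "real n * (S_op n a f x - f x)"
      let ?m2 = "x\<^sup>2 * (n * (q n - 1)\<^sup>2) + x * q n"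
      have pw: "x ^ j \<le> b ^ j" for j
        using x0 by (intro power_mono)
      have "S_op n a f x = (\<Sum>k. poisson_weight (n * x * q n) k * f (k / n))"
        using S_op_poisson[OF \<open>a > 1\<close>, of n] elim by (simp add: q_def l_def)
      then have "\<bar>?T - f' x * (x * (n * (q n - 1))) - f'' x / 2 * ?m2\<bar>
         \<le> \<epsilon> * ?m2
            + C * (exp (x * (q n * (n * (exp (1 / n) - 1)))) *
                (x ^ 4 * (n * (p n - 1) ^ 4) + 6 * x ^ 3 * ((p n - 1)\<^sup>2 * p n)
                  + 4 * x\<^sup>2 * ((p n - 1) * p n / n) + x * (p n / n\<^sup>2) + 3 * x\<^sup>2 * ((p n)\<^sup>2 / n)))"
        using poisson_mean_taylor[of n x "q n" f "f' x" "f'' x" \<epsilon> C, OF _ _ _ C(2)[OF x]]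
          elim x0 q_pos by (simp add: p_def)
      also have "\<dots> \<le> \<epsilon> * (b\<^sup>2 * (n * (q n - 1)\<^sup>2) + b * q n) + C * W n"
      proof (intro add_mono mult_left_mono \<open>C \<ge> 0\<close>)
        have "4 * x\<^sup>2 * ((p n - 1) * p n / n) \<le> 4 * x\<^sup>2 * (\<bar>p n - 1\<bar> * p n / n)"
          using p_pos by (intro mult_left_mono divide_right_mono mult_right_mono) auto
        also have "\<dots> \<le> 4 * b\<^sup>2 * (\<bar>p n - 1\<bar> * p n / n)"
          using p_pos pw by (intro mult_right_mono mult_left_mono) auto
        finally have t: "4 * x\<^sup>2 * ((p n - 1) * p n / n) \<le> 4 * b\<^sup>2 * (\<bar>p n - 1\<bar> * p n / n)" .
        let ?E = "\<lambda>x. exp (x * (q n * (n * (exp (1 / n) - 1))))"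
        let ?P = "\<lambda>x. x ^ 4 * (n * (p n - 1) ^ 4) + 6 * x ^ 3 * ((p n - 1)\<^sup>2 * p n)"
        let ?Q = "\<lambda>x. x * (p n / n\<^sup>2)" and ?R = "\<lambda>x. 3 * x\<^sup>2 * ((p n)\<^sup>2 / n)"
        have E: "?E x \<le> ?E b"
          using x0 q_pos by (auto intro!: mult_right_mono)
        have S: "?P x + 4 * x\<^sup>2 * ((p n - 1) * p n / n) + ?Q x + ?R x
            \<le> ?P b + 4 * b\<^sup>2 * (\<bar>p n - 1\<bar> * p n / n) + ?Q b + ?R b"
          using x0 p_pos pw by (intro add_mono t mult_right_mono mult_left_mono) auto
        have S0: "0 \<le> ?P b + 4 * b\<^sup>2 * (\<bar>p n - 1\<bar> * p n / n) + ?Q b + ?R b"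
          using \<open>b > 0\<close> p_pos by (intro add_nonneg_nonneg mult_nonneg_nonneg) auto
        have "?E x * (?P x + 4 * x\<^sup>2 * ((p n - 1) * p n / n) + ?Q x + ?R x)
            \<le> ?E b * (?P b + 4 * b\<^sup>2 * (\<bar>p n - 1\<bar> * p n / n) + ?Q b + ?R b)"
          by (rule order_trans[OF mult_left_mono[OF S exp_ge_zero] mult_right_mono[OF E S0]])
        then show "?E x * (?P x + 4 * x\<^sup>2 * ((p n - 1) * p n / n) + ?Q x + ?R x) \<le> W n"
          by (simp only: W_def)
      qed (use x0 q_pos pw \<open>\<epsilon> > 0\<close> in \<open>auto intro!: mult_right_mono\<close>)
      finally have main: "\<bar>?T - f' x * (x * (n * (q n - 1))) - f'' x / 2 * ?m2\<bar> \<le> \<dots>" .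
      have first: "\<bar>f' x * (x * (n * (q n - 1) + l / 2))\<bar> \<le> M * (b * \<bar>n * (q n - 1) + l / 2\<bar>)"
        unfolding abs_mult using M x x0 by (intro mult_mono) auto
      have second: "\<bar>f'' x / 2 * (x\<^sup>2 * (n * (q n - 1)\<^sup>2) + x * (q n - 1))\<bar>
          \<le> M / 2 * (b\<^sup>2 * (n * (q n - 1)\<^sup>2) + b * \<bar>q n - 1\<bar>)"
      proof -
        have "\<bar>x\<^sup>2 * (n * (q n - 1)\<^sup>2) + x * (q n - 1)\<bar>
            \<le> \<bar>x\<^sup>2 * (n * (q n - 1)\<^sup>2)\<bar> + \<bar>x * (q n - 1)\<bar>"
          by (rule abs_triangle_ineq)
        also have "\<dots> = x\<^sup>2 * (n * (q n - 1)\<^sup>2) + x * \<bar>q n - 1\<bar>"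
          using x0 by (simp add: abs_mult)
        also have "\<dots> \<le> b\<^sup>2 * (n * (q n - 1)\<^sup>2) + b * \<bar>q n - 1\<bar>"
          using x0 pw by (intro add_mono mult_right_mono) auto
        finally show ?thesis
          unfolding abs_mult using M x by (intro mult_mono) auto
      qed
      have "?T - (- x / 2 * (f' x * l - f'' x))
          = (?T - f' x * (x * (n * (q n - 1))) - f'' x / 2 * ?m2)
            + f' x * (x * (n * (q n - 1) + l / 2))
            + f'' x / 2 * (x\<^sup>2 * (n * (q n - 1)\<^sup>2) + x * (q n - 1))"
        by (simp add: field_simps)
      then have "\<bar>?T - (- x / 2 * (f' x * l - f'' x))\<bar> \<le> U n"
        using main first second unfolding U_def by linarith
      then show "dist ?T (- x / 2 * (f' x * ln a - f'' x)) < e"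
        using elim by (simp add: dist_real_def l_def)
    qed
  qed
qed

end
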